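(* Let $\mathcal B$ be a building with chamber set $C$, and let $\Delta_C$ denote its chamber graph $(C,EC)$ viewed as a $1$-dimensional simplicial complex with vertex set $C$. Then the following topologies on $\mathrm{Aut}(\mathcal B)$ coincide. (i) The topology of pointwise convergence on the discrete set $C$. (ii) The topology of pointwise convergence (as maps $|\Delta_C|\to|\Delta_C|$), for any topology on $|\Delta_C|$ in which $C$ is a discrete subset. (iii) The compact-open topology, for the weak topology on $|\Delta_C|$. Suppose that $\mathrm{Aut}(\mathcal B)$ carries this topology and that $|\Delta_C|$ carries some topology. Then the joint evaluation map $\mathrm{Aut}(\mathcal B)\times|\Delta_C|\to|\Delta_C|$ is continuous if one of the following holds. (a) The topology on $|\Delta_C|$ is $\mathrm{Aut}(\mathcal B)$-invariant and locally finite. (b) The topology on $|\Delta_C|$ comes from an $\mathrm{Aut}(\mathcal B)$-invariant metric $d$ in which $C$ is discrete.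
   Context: All topological spaces and groups are Hausdorff. Coxeter systems. Let $I$ be a finite set and $(m_{i,j})_{i,j\in I}$ a symmetric matrix with entries in $\{1,2,3,\ldots,\infty\}$, $m_{i,i}=1$ and $m_{i,j}\ge 2$ for $i\ne j$. The associated Coxeter system $(W,I)$ consists of the group $W=\langle I\mid (ij)^{m_{i,j}}=1 \text{ if } m_{i,j}\neq\infty\rangle$ and its generating set $I$; $\ell$ is the word length, and $w=i_1\cdots i_m$ is reduced if $\ell(w)=m$. Buildings. A building $\mathcal B=(C,EC,t,\delta)$ of type $(W,I)$ consists of a simplicial graph $(C,EC)$ with vertex set $C$ (the chambers) and edge set $EC$, an edge coloring $t:EC\to I$, and a map $\delta:C\times C\to W$. Chambers joined by an edge of color $i$ are called $i$-adjacent. A gallery of type $(i_1,\ldots,i_m)$ is a sequence $(c_0,\ldots,c_m)$ of chambers with $c_{s-1}$ $i_s$-adjacent to $c_s$. Axioms: (B1) for every chamber $a$ and $i\in I$ there is at least one chamber $b$ which is $i$-adjacent to $a$, and if another chamber $c$ is $i$-adjacent to $a$, then $b$ and $c$ are $i$-adjacent; (B2) if $w=i_1\cdots i_m$ is reduced, then $\delta(a,b)=w$ if and only if there is a gallery of type $(i_1,\ldots,i_m)$ from $a$ to $b$. $\mathrm{Aut}(\mathcal B)$ is the group of all graph automorphisms of $(C,EC)$ preserving the edge coloring. Simplicial complexes. A simplicial complex $\Delta$ with vertex set $V$ is a set of finite subsets of $V$, closed under passing to subsets, with $\bigcup\Delta=V$. In the real vector space $\mathbb R^{(V)}$ with basis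 $V$ let $|a|$ be the convex hull of $a\in\Delta$; the geometric realization is the set $|\Delta|=\bigcup_{a\in\Delta}|a|$. In the weak topology, $A\subseteq|\Delta|$ is closed iff $A\cap|a|$ is closed in $|a|$ (with its natural compact topology) for all $a\in\Delta$. Simplicial maps (maps between vertex sets taking simplices to simplices) are extended linearly to the geometric realizations; in this way $\mathrm{Aut}(\mathcal B)$ acts on $|\Delta_C|$. A topology on $|\Delta|$ is called locally finite if every $x\in|\Delta|$ has a neighborhood contained in the geometric realization of a finite subcomplex of $\Delta$. A topology (resp. metric) on $|\Delta_C|$ is invariant if $\mathrm{Aut}(\mathcal B)$ acts by homeomorphisms (resp. isometries). A subset is discrete if its subspace topology is discrete. *)

theory Defs
  imports
    "HOL-Analysis.Analysis"
    "HOL-Algebra.Group"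
    "HOL-Algebra.Bij"
    "HOL-Library.Extended_Nat"
    "HOL-Library.Poly_Mapping"
begin

section \<open>Group presentations and Coxeter systems\<close>

text \<open>A letter \<open>(i, True)\<close> stands for the generator \<open>i\<close>, and \<open>(i, False)\<close> for its formal inverse.\<close>

abbreviation group_words :: "'i set \<Rightarrow> ('i \<times> bool) list set" where
  "group_words I \<equiv> lists (I \<times> UNIV)"

inductive_set presentation_rel ::
    "'i set \<Rightarrow> ('i \<times> bool) list set \<Rightarrow> (('i \<times> bool) list \<times> ('i \<times> bool) list) set"
  for I :: "'i set" and R :: "('i \<times> bool) list set" where
  pres_refl: "u \<in> group_words I \<Longrightarrow> (u, u) \<in> presentation_rel I R"
| pres_sym: "(u, v) \<in> presentation_rel I R \<Longrightarrow> (v, u) \<in> presentation_rel I R"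
| pres_trans: "(u, v) \<in> presentation_rel I R \<Longrightarrow> (v, w) \<in> presentation_rel I R
    \<Longrightarrow> (u, w) \<in> presentation_rel I R"
| pres_append: "(u, v) \<in> presentation_rel I R \<Longrightarrow> (x, y) \<in> presentation_rel I R
    \<Longrightarrow> (u @ x, v @ y) \<in> presentation_rel I R"
| pres_cancel: "i \<in> I \<Longrightarrow> ([(i, b), (i, \<not> b)], []) \<in> presentation_rel I R"
| pres_relator: "r \<in> R \<Longrightarrow> r \<in> group_words I \<Longrightarrow> (r, []) \<in> presentation_rel I R"

definition presented_group ::
    "'i set \<Rightarrow> ('i \<times> bool) list set \<Rightarrow> ('i \<times> bool) list set monoid" where
  "presented_group I R =
    \<lparr>carrier = group_words I // presentation_rel I R,
     mult = (\<lambda>A B. \<Union>u\<in>A. \<Union>v\<in>B. presentation_rel I R `` {u @ v}),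
     one = presentation_rel I R `` {[]}\<rparr>"

lemma presentation_rel_words:
  "(u, v) \<in> presentation_rel I R \<Longrightarrow> u \<in> group_words I \<and> v \<in> group_words I"
  by (induction rule: presentation_rel.induct) auto

lemma equiv_presentation_rel: "equiv (group_words I) (presentation_rel I R)"
proof (rule equivI)
  show "presentation_rel I R \<subseteq> group_words I \<times> group_words I"
    using presentation_rel_words by fast
  show "refl_on (group_words I) (presentation_rel I R)"
    by (intro refl_onI presentation_rel.pres_refl)
  show "sym (presentation_rel I R)"
    by (meson symI presentation_rel.pres_sym)
  show "trans (presentation_rel I R)"
    by (meson transI presentation_rel.pres_trans)
qed

lemma mult_presented_group_class:
  assumes "u \<in> group_words I" "v \<in> group_words I"
  shows "presentation_rel I R `` {u} \<otimes>\<^bsub>presented_group I R\<^esub> presentation_rel I R `` {v}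
    = presentation_rel I R `` {u @ v}"
proof -
  let ?r = "presentation_rel I R"
  have *: "?r `` {u' @ v'} = ?r `` {u @ v}" if "u' \<in> ?r `` {u}" "v' \<in> ?r `` {v}" for u' v'
    using equiv_class_eq[OF equiv_presentation_rel presentation_rel.pres_append] that by fastforce
  have "(\<Union>u'\<in>?r `` {u}. \<Union>v'\<in>?r `` {v}. ?r `` {u' @ v'})
      = (\<Union>u'\<in>?r `` {u}. \<Union>v'\<in>?r `` {v}. ?r `` {u @ v})"
    by (intro SUP_cong HOL.refl *)
  moreover have "?r `` {u} \<noteq> {}" "?r `` {v} \<noteq> {}"
    using presentation_rel.pres_refl[OF assms(1)] presentation_rel.pres_refl[OF assms(2)] by blast+
  ultimately show ?thesis
    by (simp add: presented_group_def)
qed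

lemma presentation_rel_inverse_word:
  assumes "u \<in> group_words I"
  shows "(rev (map (\<lambda>(i, b). (i, \<not> b)) u) @ u, []) \<in> presentation_rel I R"
  using assms
proof (induction u rule: list.induct)
  case Nil
  show ?case by (auto intro: presentation_rel.pres_refl)
next
  case (Cons p u)
  obtain i b where p: "p = (i, b)" by fastforce
  let ?v = "rev (map (\<lambda>(i, b). (i, \<not> b)) u)"
  have "p \<in> I \<times> UNIV" and u: "u \<in> group_words I"
    using Cons.prems by (simp_all only: Cons_in_lists_iff)
  then have "i \<in> I" using p by simp
  have v: "?v \<in> group_words I" using u by (auto simp: in_lists_conv_set)
  have "([(i, \<not> b), (i, b)], []) \<in> presentation_rel I R"
    using presentation_rel.pres_cancel[OF \<open>i \<in> I\<close>, of "\<not> b"] by simp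
  then have "(?v @ [(i, \<not> b), (i, b)] @ u, ?v @ [] @ u) \<in> presentation_rel I R"
    using u v by (intro presentation_rel.pres_append presentation_rel.pres_refl) auto
  then have "(?v @ [(i, \<not> b), (i, b)] @ u, []) \<in> presentation_rel I R"
    using presentation_rel.pres_trans[OF _ Cons.IH[OF u]] by simp
  then show ?case by (simp add: p)
qed

lemma group_presented_group: "group (presented_group I R)"
proof (rule groupI)
  let ?G = "presented_group I R" and ?c = "\<lambda>u. presentation_rel I R `` {u}"
  have carr: "x \<in> carrier ?G \<longleftrightarrow> (\<exists>u\<in>group_words I. x = ?c u)" for x
    by (auto simp: presented_group_def quotient_def)
  have one: "\<one>\<^bsub>?G\<^esub> = ?c []"
    by (simp add: presented_group_def)
  show "\<one>\<^bsub>?G\<^esub> \<in> carrier ?G"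
    unfolding carr one by blast
  show "x \<otimes>\<^bsub>?G\<^esub> y \<in> carrier ?G" if "x \<in> carrier ?G" "y \<in> carrier ?G" for x y
  proof -
    obtain u v where "u \<in> group_words I" "v \<in> group_words I" "x = ?c u" "y = ?c v"
      using \<open>x \<in> _\<close> \<open>y \<in> _\<close> unfolding carr by metis
    then show ?thesis
      unfolding carr by (auto simp: mult_presented_group_class intro!: bexI[of _ "u @ v"])
  qed
  show "x \<otimes>\<^bsub>?G\<^esub> y \<otimes>\<^bsub>?G\<^esub> z = x \<otimes>\<^bsub>?G\<^esub> (y \<otimes>\<^bsub>?G\<^esub> z)"
    if "x \<in> carrier ?G" "y \<in> carrier ?G" "z \<in> carrier ?G" for x y z
  proof -
    obtain u v w where "u \<in> group_words I" "v \<in> group_words I" "w \<in> group_words I"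
      "x = ?c u" "y = ?c v" "z = ?c w"
      using \<open>x \<in> _\<close> \<open>y \<in> _\<close> \<open>z \<in> _\<close> unfolding carr by metis
    then show ?thesis by (simp add: mult_presented_group_class append_in_lists_conv)
  qed
  show "\<one>\<^bsub>?G\<^esub> \<otimes>\<^bsub>?G\<^esub> x = x" if "x \<in> carrier ?G" for x
  proof -
    obtain u where u: "u \<in> group_words I" "x = ?c u"
      using \<open>x \<in> _\<close> unfolding carr by metis
    then show ?thesis
      unfolding one using mult_presented_group_class[of "[]" I u R] by simp
  qed
  show "\<exists>y\<in>carrier ?G. y \<otimes>\<^bsub>?G\<^esub> x = \<one>\<^bsub>?G\<^esub>" if "x \<in> carrier ?G" for x
  proof -
    obtain u where u: "u \<in> group_words I" "x = ?c u"
      using \<open>x \<in> _\<close> unfolding carr by metis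
    let ?v = "rev (map (\<lambda>(i, b). (i, \<not> b)) u)"
    have v: "?v \<in> group_words I" using u by (auto simp: in_lists_conv_set)
    have "?c (?v @ u) = ?c []"
      using equiv_class_eq[OF equiv_presentation_rel presentation_rel_inverse_word[OF u(1)]] .
    then show ?thesis
      unfolding carr one using u v by (intro bexI[of _ "?c ?v"]) (auto simp: mult_presented_group_class carr)
  qed
qed

locale coxeter_matrix =
  fixes I :: "'i set" and m :: "'i \<Rightarrow> 'i \<Rightarrow> enat"
  assumes finite_I: "finite I"
    and m_sym: "\<And>i j. i \<in> I \<Longrightarrow> j \<in> I \<Longrightarrow> m i j = m j i"
    and m_diag: "\<And>i. i \<in> I \<Longrightarrow> m i i = 1"
    and m_off_diag: "\<And>i j. i \<in> I \<Longrightarrow> j \<in> I \<Longrightarrow> i \<noteq> j \<Longrightarrow> 2 \<le> m i j"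

definition coxeter_relators :: "'i set \<Rightarrow> ('i \<Rightarrow> 'i \<Rightarrow> enat) \<Rightarrow> ('i \<times> bool) list set" where
  "coxeter_relators I m =
    {concat (replicate n [(i, True), (j, True)]) | i j n. i \<in> I \<and> j \<in> I \<and> m i j = enat n}"

definition coxeter_group ::
    "'i set \<Rightarrow> ('i \<Rightarrow> 'i \<Rightarrow> enat) \<Rightarrow> ('i \<times> bool) list set monoid" where
  "coxeter_group I m = presented_group I (coxeter_relators I m)"

definition coxeter_gen :: "'i set \<Rightarrow> ('i \<Rightarrow> 'i \<Rightarrow> enat) \<Rightarrow> 'i \<Rightarrow> ('i \<times> bool) list set" where
  "coxeter_gen I m i = presentation_rel I (coxeter_relators I m) `` {[(i, True)]}"

definition coxeter_prod :: "'i set \<Rightarrow> ('i \<Rightarrow> 'i \<Rightarrow> enat) \<Rightarrow> 'i list \<Rightarrow> ('i \<times> bool) list set" where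
  "coxeter_prod I m is =
    foldr (\<lambda>i w. coxeter_gen I m i \<otimes>\<^bsub>coxeter_group I m\<^esub> w) is \<one>\<^bsub>coxeter_group I m\<^esub>"

definition coxeter_length :: "'i set \<Rightarrow> ('i \<Rightarrow> 'i \<Rightarrow> enat) \<Rightarrow> ('i \<times> bool) list set \<Rightarrow> nat" where
  "coxeter_length I m w = (LEAST n. \<exists>is\<in>lists I. length is = n \<and> coxeter_prod I m is = w)"

definition reduced_word :: "'i set \<Rightarrow> ('i \<Rightarrow> 'i \<Rightarrow> enat) \<Rightarrow> 'i list \<Rightarrow> bool" where
  "reduced_word I m is \<longleftrightarrow>
    is \<in> lists I \<and> coxeter_length I m (coxeter_prod I m is) = length is"

section \<open>Buildings and their automorphisms\<close>

definition adjacent :: "'c set set \<Rightarrow> ('c set \<Rightarrow> 'i) \<Rightarrow> 'i \<Rightarrow> 'c \<Rightarrow> 'c \<Rightarrow> bool" where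
  "adjacent EC t i a b \<longleftrightarrow> {a, b} \<in> EC \<and> t {a, b} = i"

definition gallery ::
    "'c set \<Rightarrow> 'c set set \<Rightarrow> ('c set \<Rightarrow> 'i) \<Rightarrow> 'i list \<Rightarrow> 'c list \<Rightarrow> bool" where
  "gallery C EC t is cs \<longleftrightarrow> cs \<in> lists C \<and> length cs = Suc (length is) \<and>
    (\<forall>s<length is. adjacent EC t (is ! s) (cs ! s) (cs ! Suc s))"

locale building = coxeter_matrix I m
  for I :: "'i set" and m :: "'i \<Rightarrow> 'i \<Rightarrow> enat" +
  fixes C :: "'c set" and EC :: "'c set set" and t :: "'c set \<Rightarrow> 'i"
    and \<delta> :: "'c \<Rightarrow> 'c \<Rightarrow> ('i \<times> bool) list set"
  assumes edges: "EC \<subseteq> {e. e \<subseteq> C \<and> card e = 2}"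
    and coloring: "t \<in> EC \<rightarrow> I"
    and dist_in_W: "\<And>a b. a \<in> C \<Longrightarrow> b \<in> C \<Longrightarrow> \<delta> a b \<in> carrier (coxeter_group I m)"
    and B1_ex: "\<And>a i. a \<in> C \<Longrightarrow> i \<in> I \<Longrightarrow> \<exists>b\<in>C. adjacent EC t i a b"
    and B1_trans: "\<And>a b c i. a \<in> C \<Longrightarrow> i \<in> I \<Longrightarrow> b \<in> C \<Longrightarrow> c \<in> C \<Longrightarrow> b \<noteq> c \<Longrightarrow>
      adjacent EC t i a b \<Longrightarrow> adjacent EC t i a c \<Longrightarrow> adjacent EC t i b c"
    and B2: "\<And>is a b. reduced_word I m is \<Longrightarrow> a \<in> C \<Longrightarrow> b \<in> C \<Longrightarrow>
      \<delta> a b = coxeter_prod I m is \<longleftrightarrow>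
      (\<exists>cs. gallery C EC t is cs \<and> hd cs = a \<and> last cs = b)"

text \<open>Elements of \<^const>\<open>Bij\<close> are \<^const>\<open>undefined\<close> outside the given set, so distinct elements
  of the following set are distinct automorphisms.\<close>

definition building_aut :: "'c set \<Rightarrow> 'c set set \<Rightarrow> ('c set \<Rightarrow> 'i) \<Rightarrow> ('c \<Rightarrow> 'c) set" where
  "building_aut C EC t = {g \<in> Bij C.
    (\<forall>a\<in>C. \<forall>b\<in>C. {a, b} \<in> EC \<longleftrightarrow> {g a, g b} \<in> EC) \<and>
    (\<forall>a\<in>C. \<forall>b\<in>C. {a, b} \<in> EC \<longrightarrow> t {g a, g b} = t {a, b})}"

section \<open>Simplicial complexes and geometric realizations\<close>

text \<open>For a set \<open>V\<close> of elements of type \<open>'v\<close>, the space \<open>\<real>\<^sup>(\<^sup>V\<^sup>)\<close> is a subspace of the type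
  \<open>'v \<Rightarrow>\<^sub>0 real\<close> of finitely supported functions, with the basis vectors \<open>vertex v\<close>.\<close>

instantiation poly_mapping :: (type, real_vector) real_vector
begin

lift_definition scaleR_poly_mapping :: "real \<Rightarrow> ('a \<Rightarrow>\<^sub>0 'b) \<Rightarrow> 'a \<Rightarrow>\<^sub>0 'b"
  is "\<lambda>r f k. r *\<^sub>R f k"
  by (rule finite_subset) auto

instance
  by standard (transfer; simp add: fun_eq_iff scaleR_add_right scaleR_add_left)+

end

definition vertex :: "'v \<Rightarrow> 'v \<Rightarrow>\<^sub>0 real" where
  "vertex v = Poly_Mapping.single v 1"

definition abstract_simplicial_complex :: "'v set \<Rightarrow> 'v set set \<Rightarrow> bool" where
  "abstract_simplicial_complex V \<Delta> \<longleftrightarrow>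
    (\<forall>a\<in>\<Delta>. finite a \<and> a \<subseteq> V) \<and> (\<forall>a\<in>\<Delta>. \<forall>b. b \<subseteq> a \<longrightarrow> b \<in> \<Delta>) \<and> \<Union>\<Delta> = V"

definition simplex_realization :: "'v set \<Rightarrow> ('v \<Rightarrow>\<^sub>0 real) set" where
  "simplex_realization a = convex hull (vertex ` a)"

definition realization :: "'v set set \<Rightarrow> ('v \<Rightarrow>\<^sub>0 real) set" where
  "realization \<Delta> = (\<Union>a\<in>\<Delta>. simplex_realization a)"

text \<open>The linear extension of a map between vertex sets.\<close>

definition realize_map :: "('v \<Rightarrow> 'w) \<Rightarrow> ('v \<Rightarrow>\<^sub>0 real) \<Rightarrow> ('w \<Rightarrow>\<^sub>0 real)" where
  "realize_map f x = (\<Sum>v\<in>Poly_Mapping.keys x. Poly_Mapping.lookup x v *\<^sub>R vertex (f v))"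

text \<open>The natural topology of a (finite-dimensional) simplex is that of coordinatewise
  convergence.\<close>

definition simplex_topology :: "'v set \<Rightarrow> ('v \<Rightarrow>\<^sub>0 real) topology" where
  "simplex_topology a =
    pullback_topology (simplex_realization a) Poly_Mapping.lookup (powertop_real UNIV)"

definition weak_topology :: "'v set set \<Rightarrow> ('v \<Rightarrow>\<^sub>0 real) topology" where
  "weak_topology \<Delta> = topology (\<lambda>U. U \<subseteq> realization \<Delta> \<and>
    (\<forall>a\<in>\<Delta>. closedin (simplex_topology a) ((realization \<Delta> - U) \<inter> simplex_realization a)))"

lemma topspace_simplex_topology [simp]: "topspace (simplex_topology a) = simplex_realization a"
  by (simp add: simplex_topology_def topspace_pullback_topology)

lemma openin_weak_topology:
  "openin (weak_topology \<Delta>) U \<longleftrightarrow> U \<subseteq> realization \<Delta> \<and>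
    (\<forall>a\<in>\<Delta>. closedin (simplex_topology a) ((realization \<Delta> - U) \<inter> simplex_realization a))"
proof -
  let ?X = "realization \<Delta>"
  have eq: "closedin (simplex_topology a) ((?X - U) \<inter> simplex_realization a)
      \<longleftrightarrow> openin (simplex_topology a) (U \<inter> simplex_realization a)"
    if "a \<in> \<Delta>" for a U
  proof -
    have "simplex_realization a - ((?X - U) \<inter> simplex_realization a) = U \<inter> simplex_realization a"
      using that by (auto simp: realization_def)
    then show ?thesis by (simp add: closedin_def)
  qed
  have "istopology (\<lambda>U. U \<subseteq> ?X \<and> (\<forall>a\<in>\<Delta>. openin (simplex_topology a) (U \<inter> simplex_realization a)))"
    unfolding istopology_def
  proof (intro conjI allI impI ballI)
    fix S T a
    assume "S \<subseteq> ?X \<and> (\<forall>a\<in>\<Delta>. openin (simplex_topology a) (S \<inter> simplex_realization a))"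
      "T \<subseteq> ?X \<and> (\<forall>a\<in>\<Delta>. openin (simplex_topology a) (T \<inter> simplex_realization a))" "a \<in> \<Delta>"
    moreover have "(S \<inter> T) \<inter> simplex_realization a
        = (S \<inter> simplex_realization a) \<inter> (T \<inter> simplex_realization a)"
      by blast
    ultimately show "openin (simplex_topology a) ((S \<inter> T) \<inter> simplex_realization a)"
      by (simp add: openin_Int)
  next
    fix \<K> a
    assume *: "\<forall>K\<in>\<K>. K \<subseteq> ?X \<and> (\<forall>a\<in>\<Delta>. openin (simplex_topology a) (K \<inter> simplex_realization a))"
      and "a \<in> \<Delta>"
    then have "openin (simplex_topology a) (\<Union>K\<in>\<K>. K \<inter> simplex_realization a)"
      by blast
    then show "openin (simplex_topology a) (\<Union>\<K> \<inter> simplex_realization a)"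
      by (simp add: Int_commute Int_Union)
  qed blast+
  then show ?thesis
    unfolding weak_topology_def by (simp add: topology_inverse' eq cong: conj_cong)
qed

lemma topspace_weak_topology [simp]: "topspace (weak_topology \<Delta>) = realization \<Delta>"
  by (rule antisym)
    (auto simp: topspace_def openin_weak_topology intro!: exI[of _ "realization \<Delta>"])

lemma closedin_weak_topology:
  "closedin (weak_topology \<Delta>) A \<longleftrightarrow> A \<subseteq> realization \<Delta> \<and>
    (\<forall>a\<in>\<Delta>. closedin (simplex_topology a) (A \<inter> simplex_realization a))"
  by (auto simp: closedin_def[of "weak_topology \<Delta>"] openin_weak_topology double_diff)

definition locally_finite_topology :: "'v set set \<Rightarrow> ('v \<Rightarrow>\<^sub>0 real) topology \<Rightarrow> bool" where
  "locally_finite_topology \<Delta> T \<longleftrightarrow> (\<forall>x\<in>realization \<Delta>. \<exists>U F.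
    openin T U \<and> x \<in> U \<and> F \<subseteq> \<Delta> \<and> finite F \<and> abstract_simplicial_complex (\<Union>F) F \<and> U \<subseteq> realization F)"

definition chamber_complex :: "'c set \<Rightarrow> 'c set set \<Rightarrow> 'c set set" where
  "chamber_complex C EC = {{}} \<union> (\<lambda>c. {c}) ` C \<union> EC"

lemma (in building) abstract_simplicial_complex_chamber_complex:
  "abstract_simplicial_complex C (chamber_complex C EC)"
proof -
  have E: "e \<subseteq> C \<and> finite e \<and> card e = 2" if "e \<in> EC" for e
    using that edges card.infinite[of e] by fastforce
  have "b \<in> chamber_complex C EC" if "e \<in> EC" "b \<subseteq> e" for b e
  proof -
    obtain x y where "e = {x, y}" using E[OF \<open>e \<in> EC\<close>] by (auto simp: card_2_iff)
    then have "b \<in> {{}, {x}, {y}, e}" using that(2) by auto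
    then show ?thesis using E[OF that(1)] that(1) \<open>e = {x, y}\<close> by (auto simp: chamber_complex_def)
  qed
  then show ?thesis
    unfolding abstract_simplicial_complex_def using E
    by (auto simp: chamber_complex_def subset_singleton_iff)
qed

section \<open>Function space topologies\<close>

definition discrete_subset :: "'a topology \<Rightarrow> 'a set \<Rightarrow> bool" where
  "discrete_subset T S \<longleftrightarrow> S \<subseteq> topspace T \<and> subtopology T S = discrete_topology S"

definition compact_open_topology :: "'a topology \<Rightarrow> 'b topology \<Rightarrow> ('a \<Rightarrow> 'b) topology" where
  "compact_open_topology X Y = topology_generated_by
    {{f \<in> extensional (topspace X). continuous_map X Y f \<and> f ` K \<subseteq> U} | K U.
      compactin X K \<and> openin Y U}"

text \<open>The next two definitions topologize a set \<open>G\<close> whose elements \<open>g\<close> act as maps \<open>\<phi> g\<close>, by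
  pulling back the function space topology along \<open>\<phi>\<close>.  The library's function spaces consist of
  functions that are \<^const>\<open>undefined\<close> off their domain, whence the restrictions.\<close>

definition pointwise_topology ::
    "'g set \<Rightarrow> ('g \<Rightarrow> 'a \<Rightarrow> 'b) \<Rightarrow> 'a set \<Rightarrow> 'b topology \<Rightarrow> 'g topology" where
  "pointwise_topology G \<phi> X Y =
    pullback_topology G (\<lambda>g. restrict (\<phi> g) X) (product_topology (\<lambda>_. Y) X)"

definition induced_compact_open_topology ::
    "'g set \<Rightarrow> ('g \<Rightarrow> 'a \<Rightarrow> 'b) \<Rightarrow> 'a topology \<Rightarrow> 'b topology \<Rightarrow> 'g topology" where
  "induced_compact_open_topology G \<phi> X Y =
    pullback_topology G (\<lambda>g. restrict (\<phi> g) (topspace X)) (compact_open_topology X Y)"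

definition invariant_topology ::
    "'g set \<Rightarrow> ('g \<Rightarrow> 'a \<Rightarrow> 'a) \<Rightarrow> 'a topology \<Rightarrow> bool" where
  "invariant_topology G \<phi> T \<longleftrightarrow> (\<forall>g\<in>G. homeomorphic_map T T (\<phi> g))"

definition invariant_metric ::
    "'g set \<Rightarrow> ('g \<Rightarrow> 'a \<Rightarrow> 'a) \<Rightarrow> 'a set \<Rightarrow> ('a \<Rightarrow> 'a \<Rightarrow> real) \<Rightarrow> bool" where
  "invariant_metric G \<phi> X d \<longleftrightarrow> Metric_space X d \<and>
    (\<forall>g\<in>G. bij_betw (\<phi> g) X X \<and> (\<forall>x\<in>X. \<forall>y\<in>X. d (\<phi> g x) (\<phi> g y) = d x y))"

end

theory Submission
  imports Defs
begin

text \<open>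
  The topology of pointwise convergence on the discrete chamber set has a transparent local
  structure: the automorphisms that agree with \<open>g\<close> on a given finite set of chambers form an open
  neighbourhood of \<open>g\<close>. On the other hand, a point \<open>x\<close> of the realization lies in a finite simplex,
  so \<open>realize_map g x\<close> depends only on the values of \<open>g\<close> on the finite set \<open>keys x\<close>. Every part of
  the theorem combines these two facts.

  For the pointwise topologies on the realization, evaluation at \<open>x\<close> is locally constant in \<open>g\<close>,
  hence continuous for any topology on the target. Conversely, evaluation at a vertex recovers
  \<open>g\<close> on a chamber as soon as the vertices form a discrete subset. For the compact-open topology,
  a weakly compact set has finite total support (\<open>finite_support_of_weakly_compact\<close>), so whether
  \<open>g\<close> maps it into a given open set depends again on finitely many values of \<open>g\<close>; conversely,
  the open star of a vertex \<open>w\<close> is weakly open and contains no other vertex, so the compact-open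
  topology detects the condition that \<open>g\<close> maps \<open>v\<close> to \<open>w\<close>.

  For the joint evaluation map near \<open>(g, x)\<close>, consider automorphisms \<open>h\<close> that agree with \<open>g\<close> on a
  suitable finite set. If \<open>x\<close> has a neighbourhood inside a finite subcomplex, \<open>h\<close> and \<open>g\<close> coincide
  on this neighbourhood, and continuity of \<open>g\<close> is enough. If the metric \<open>d\<close> is invariant, then
  agreement on \<open>keys x\<close> gives \<open>d (h y) (g x) = d (h y) (h x) = d y x\<close>.

  Automorphisms of a building act on its chamber graph by simplicial maps, so the argument is
  carried out for a set of simplicial self-maps of an arbitrary simplicial complex.
\<close>

section \<open>Linear extensions of maps between vertex sets\<close>

lemma lookup_sum: "Poly_Mapping.lookup (\<Sum>v\<in>A. f v) w = (\<Sum>v\<in>A. Poly_Mapping.lookup (f v) w)"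
  by (induction A rule: infinite_finite_induct) (simp_all add: lookup_add)

lemma lookup_scaleR: "Poly_Mapping.lookup (r *\<^sub>R x) w = r *\<^sub>R Poly_Mapping.lookup x w"
  by transfer simp

lemma lookup_vertex: "Poly_Mapping.lookup (vertex v) w = (if v = w then 1 else 0)"
  by (simp add: vertex_def lookup_single when_def)

lemma keys_vertex [simp]: "Poly_Mapping.keys (vertex v) = {v}"
  by (simp add: vertex_def)

lemma vertex_eq_iff [simp]: "vertex v = vertex w \<longleftrightarrow> v = w"
  by (metis keys_vertex singleton_inject)

lemma realize_map_vertex [simp]: "realize_map f (vertex v) = vertex (f v)"
  by (simp add: realize_map_def lookup_vertex)

lemma realize_map_cong:
  assumes "\<And>v. v \<in> Poly_Mapping.keys x \<Longrightarrow> f v = g v"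
  shows "realize_map f x = realize_map g x"
  unfolding realize_map_def using assms by simp

lemma realize_map_finite_superset:
  assumes "finite A" "Poly_Mapping.keys x \<subseteq> A"
  shows "realize_map f x = (\<Sum>v\<in>A. Poly_Mapping.lookup x v *\<^sub>R vertex (f v))"
  unfolding realize_map_def using assms
  by (intro sum.mono_neutral_left) (auto simp: in_keys_iff)

text \<open>Linearity is not immediate from the definition, because the index set \<open>keys x\<close> of the sum
  varies with \<open>x\<close>; over a common finite superset of the supports it becomes visible.\<close>

lemma linear_realize_map: "linear (realize_map f)"
proof
  fix x y :: "'a \<Rightarrow>\<^sub>0 real" and r :: real
  let ?A = "Poly_Mapping.keys x \<union> Poly_Mapping.keys y"
  have sub: "Poly_Mapping.keys (x + y) \<subseteq> ?A" "Poly_Mapping.keys x \<subseteq> ?A"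
    "Poly_Mapping.keys y \<subseteq> ?A" "Poly_Mapping.keys (r *\<^sub>R x) \<subseteq> ?A"
    by (auto simp: in_keys_iff lookup_add lookup_scaleR)
  have eq: "realize_map f z = (\<Sum>v\<in>?A. Poly_Mapping.lookup z v *\<^sub>R vertex (f v))"
    if "Poly_Mapping.keys z \<subseteq> ?A" for z
    using that by (intro realize_map_finite_superset) simp_all
  show "realize_map f (x + y) = realize_map f x + realize_map f y"
    unfolding eq[OF sub(1)] eq[OF sub(2)] eq[OF sub(3)] lookup_add scaleR_add_left sum.distrib ..
  show "realize_map f (r *\<^sub>R x) = r *\<^sub>R realize_map f x"
    unfolding eq[OF sub(2)] eq[OF sub(4)] lookup_scaleR scaleR_sum_right by simp
qed

lemma realize_map_simplex:
  "realize_map f ` simplex_realization a = simplex_realization (f ` a)"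
  unfolding simplex_realization_def
  by (simp add: convex_hull_linear_image[OF linear_realize_map] image_image)

lemma keys_subset_simplex:
  assumes "x \<in> simplex_realization a"
  shows "Poly_Mapping.keys x \<subseteq> a"
proof -
  have "convex {x :: 'a \<Rightarrow>\<^sub>0 real. Poly_Mapping.keys x \<subseteq> a}"
    by (rule convexI)
      (auto simp: in_keys_iff lookup_add lookup_scaleR subset_iff, metis add_0 mult_zero_right)
  then have "simplex_realization a \<subseteq> {x. Poly_Mapping.keys x \<subseteq> a}"
    unfolding simplex_realization_def by (intro hull_minimal) auto
  then show ?thesis using assms by blast
qed

section \<open>The weak topology\<close>

lemma continuous_map_lookup_simplex:
  "continuous_map (simplex_topology a) euclideanreal (\<lambda>x. Poly_Mapping.lookup x w)"
proof -
  have "continuous_map (powertop_real UNIV) euclideanreal (\<lambda>f. f w)"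
    by (rule continuous_map_product_projection) simp
  from continuous_map_pullback[OF this] show ?thesis
    unfolding simplex_topology_def by (simp add: o_def)
qed

lemma continuous_map_into_simplex:
  assumes "g \<in> topspace X \<rightarrow> simplex_realization a"
    and "\<And>w. continuous_map X euclideanreal (\<lambda>x. Poly_Mapping.lookup (g x) w)"
  shows "continuous_map X (simplex_topology a) g"
  unfolding simplex_topology_def using assms
  by (intro continuous_map_pullback') (auto simp: continuous_map_componentwise_UNIV o_def)

lemma Hausdorff_simplex_topology: "Hausdorff_space (simplex_topology a)"
proof (rule Hausdorff_space_injective_preimage)
  show "Hausdorff_space (powertop_real (UNIV :: 'a set))"
    by (simp add: Hausdorff_space_product_topology)
  show "continuous_map (simplex_topology a) (powertop_real UNIV) Poly_Mapping.lookup"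
    by (simp add: continuous_map_componentwise_UNIV continuous_map_lookup_simplex)
  show "inj_on Poly_Mapping.lookup (topspace (simplex_topology a))"
    by (simp add: inj_on_def)
qed

text \<open>The coordinates of the image of a point are finite sums of coordinates of that point, which
  is why a simplicial map is continuous on each simplex.\<close>

lemma continuous_map_realize_map_simplex:
  assumes "finite a"
  shows "continuous_map (simplex_topology a) (simplex_topology (f ` a)) (realize_map f)"
proof (rule continuous_map_into_simplex)
  show "realize_map f \<in> topspace (simplex_topology a) \<rightarrow> simplex_realization (f ` a)"
    using realize_map_simplex[of f a] by auto
next
  fix w
  have "continuous_map (simplex_topology a) euclideanreal
      (\<lambda>x. \<Sum>v\<in>a. Poly_Mapping.lookup x v * Poly_Mapping.lookup (vertex (f v)) w)"
    using assms
    by (intro continuous_map_sum continuous_map_real_mult continuous_map_lookup_simplex)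
      simp_all
  moreover have "(\<Sum>v\<in>a. Poly_Mapping.lookup x v * Poly_Mapping.lookup (vertex (f v)) w)
      = Poly_Mapping.lookup (realize_map f x) w"
    if "x \<in> topspace (simplex_topology a)" for x
  proof -
    have "Poly_Mapping.keys x \<subseteq> a" using that keys_subset_simplex by simp
    from realize_map_finite_superset[OF assms this, of f] show ?thesis
      by (simp only: lookup_sum lookup_scaleR real_scaleR_def)
  qed
  ultimately show "continuous_map (simplex_topology a) euclideanreal
      (\<lambda>x. Poly_Mapping.lookup (realize_map f x) w)"
    by (rule continuous_map_eq)
qed

lemma continuous_map_from_weak:
  assumes "\<And>a. a \<in> \<Delta> \<Longrightarrow> continuous_map (simplex_topology a) Y g"
  shows "continuous_map (weak_topology \<Delta>) Y g"
  unfolding continuous_map_closedin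
proof (intro conjI allI impI)
  show "g \<in> topspace (weak_topology \<Delta>) \<rightarrow> topspace Y"
    using assms by (fastforce simp: realization_def dest: continuous_map_funspace)
next
  fix D assume "closedin Y D"
  have "{x \<in> realization \<Delta>. g x \<in> D} \<inter> simplex_realization a
      = {x \<in> topspace (simplex_topology a). g x \<in> D}" if "a \<in> \<Delta>" for a
    using that by (auto simp: realization_def)
  then show "closedin (weak_topology \<Delta>) {x \<in> topspace (weak_topology \<Delta>). g x \<in> D}"
    using closedin_continuous_map_preimage[OF assms \<open>closedin Y D\<close>]
    by (simp add: closedin_weak_topology)
qed

lemma continuous_map_simplex_weak:
  assumes "a \<in> \<Delta>"
  shows "continuous_map (simplex_topology a) (weak_topology \<Delta>) (\<lambda>x. x)"
  unfolding continuous_map_closedin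
proof (intro conjI allI impI)
  show "(\<lambda>x. x) \<in> topspace (simplex_topology a) \<rightarrow> topspace (weak_topology \<Delta>)"
    using assms by (auto simp: realization_def)
next
  fix D assume "closedin (weak_topology \<Delta>) D"
  then have "closedin (simplex_topology a) (D \<inter> simplex_realization a)"
    using assms by (simp add: closedin_weak_topology)
  then show "closedin (simplex_topology a) {x \<in> topspace (simplex_topology a). x \<in> D}"
    by (simp add: Int_def conj_commute)
qed

lemma continuous_map_realize_map_weak:
  assumes "\<And>a. a \<in> \<Delta> \<Longrightarrow> finite a" and "\<And>a. a \<in> \<Delta> \<Longrightarrow> f ` a \<in> \<Delta>'"
  shows "continuous_map (weak_topology \<Delta>) (weak_topology \<Delta>') (realize_map f)"
proof (rule continuous_map_from_weak)
  fix a assume "a \<in> \<Delta>"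
  from continuous_map_compose[OF continuous_map_realize_map_simplex[OF assms(1)[OF this]]
      continuous_map_simplex_weak[OF assms(2)[OF this]]]
  show "continuous_map (simplex_topology a) (weak_topology \<Delta>') (realize_map f)"
    by (simp add: o_def)
qed

text \<open>The open star of the vertex \<open>w\<close> consists of the points whose \<open>w\<close>-coordinate is positive; on
  a realization this is the same as being nonzero.\<close>

lemma openin_weak_open_star:
  "openin (weak_topology \<Delta>) {x \<in> realization \<Delta>. w \<in> Poly_Mapping.keys x}"
proof -
  have "continuous_map (weak_topology \<Delta>) euclideanreal (\<lambda>x. Poly_Mapping.lookup x w)"
    by (intro continuous_map_from_weak continuous_map_lookup_simplex)
  from openin_continuous_map_preimage[OF this, of "- {0}"] show ?thesis
    by (simp add: in_keys_iff open_Compl)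
qed

text \<open>If infinitely many vertices occurred in the supports of points of \<open>K\<close>, one could choose for
  each such vertex a point of \<open>K\<close> supported there. Any simplex contains only finitely many of the
  chosen points, because the vertex for which a point was chosen belongs to its support. So every set of chosen points is closed,
  which makes them an infinite subset of \<open>K\<close> without accumulation points.\<close>

lemma finite_support_of_weakly_compact:
  assumes fin: "\<And>a. a \<in> \<Delta> \<Longrightarrow> finite a" and K: "compactin (weak_topology \<Delta>) K"
  shows "finite (\<Union>x\<in>K. Poly_Mapping.keys x)"
proof (rule ccontr)
  define S where "S = (\<Union>x\<in>K. Poly_Mapping.keys x)"
  assume "infinite (\<Union>x\<in>K. Poly_Mapping.keys x)"
  then have inf: "infinite S" by (simp add: S_def)
  have "\<forall>v\<in>S. \<exists>x. x \<in> K \<and> v \<in> Poly_Mapping.keys x" unfolding S_def by blast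
  from bchoice[OF this] obtain p where
    p: "\<forall>v\<in>S. p v \<in> K \<and> v \<in> Poly_Mapping.keys (p v)" by (rule exE)
  define A where "A = p ` S"
  have AK: "A \<subseteq> K" using p by (auto simp: A_def)
  have KX: "K \<subseteq> realization \<Delta>"
    using compactin_subset_topspace[OF K] by simp
  have closed: "closedin (weak_topology \<Delta>) B" if B: "B \<subseteq> A" for B
    unfolding closedin_weak_topology
  proof (intro conjI ballI)
    show "B \<subseteq> realization \<Delta>" using B AK KX by (rule order_trans[OF order_trans])
    fix a assume a: "a \<in> \<Delta>"
    have "B \<inter> simplex_realization a \<subseteq> p ` a"
    proof
      fix x assume x: "x \<in> B \<inter> simplex_realization a"
      then obtain v where v: "v \<in> S" "x = p v" using B by (auto simp: A_def)
      moreover have "v \<in> Poly_Mapping.keys x" using p v by simp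
      moreover have "Poly_Mapping.keys x \<subseteq> a" using IntD2[OF x] by (rule keys_subset_simplex)
      ultimately show "x \<in> p ` a" by blast
    qed
    then have "finite (B \<inter> simplex_realization a)"
      using finite_subset finite_imageI[OF fin[OF a]] by blast
    then show "closedin (simplex_topology a) (B \<inter> simplex_realization a)"
      by (intro closedin_Hausdorff_finite Hausdorff_simplex_topology) simp_all
  qed
  have "infinite A"
  proof
    assume "finite A"
    then have "finite (\<Union>x\<in>A. Poly_Mapping.keys x)" by simp
    moreover have "S \<subseteq> (\<Union>x\<in>A. Poly_Mapping.keys x)" using p by (auto simp: A_def)
    ultimately show False using inf finite_subset by blast
  qed
  then have "K \<inter> weak_topology \<Delta> derived_set_of A \<noteq> {}"
    using AK by (intro compactin_imp_Bolzano_Weierstrass[OF K] conjI)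
  then obtain q where q: "q \<in> weak_topology \<Delta> derived_set_of A" by blast
  define U where "U = topspace (weak_topology \<Delta>) - (A - {q})"
  have "closedin (weak_topology \<Delta>) (A - {q})" by (rule closed) (rule Diff_subset)
  then have "openin (weak_topology \<Delta>) U"
    unfolding U_def by (rule openin_diff[OF openin_topspace])
  moreover have "q \<in> topspace (weak_topology \<Delta>)"
    using q unfolding in_derived_set_of by (rule conjunct1)
  then have "q \<in> U" by (simp add: U_def)
  ultimately have "\<exists>y. y \<noteq> q \<and> y \<in> A \<and> y \<in> U"
    using q unfolding in_derived_set_of by simp
  then show False by (auto simp: U_def)
qed

section \<open>Topologies pulled back along an action\<close>

lemma topology_eqI_continuous_id:
  assumes "topspace S = topspace T" "continuous_map S T (\<lambda>x. x)" "continuous_map T S (\<lambda>x. x)"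
  shows "S = T"
  using assms topology_finer_continuous_id[of S T] topology_finer_continuous_id[of T S]
  by (auto simp: topology_eq id_def)

lemma topspace_pointwise_topology:
  "topspace (pointwise_topology G \<phi> X Y) = {g \<in> G. \<forall>x\<in>X. \<phi> g x \<in> topspace Y}"
  by (auto simp: pointwise_topology_def topspace_pullback_topology PiE_iff)

lemma continuous_map_evaluation:
  assumes "x \<in> X"
  shows "continuous_map (pointwise_topology G \<phi> X Y) Y (\<lambda>g. \<phi> g x)"
proof -
  have "continuous_map (product_topology (\<lambda>_. Y) X) Y (\<lambda>f. f x)"
    using assms by (rule continuous_map_product_projection)
  from continuous_map_pullback[OF this, of G "\<lambda>g. restrict (\<phi> g) X"] show ?thesis
    unfolding pointwise_topology_def using assms by (simp add: o_def)
qed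

lemma continuous_map_into_pointwise_topology:
  assumes "topspace S \<subseteq> G" and "\<And>x. x \<in> X \<Longrightarrow> continuous_map S Y (\<lambda>g. \<phi> g x)"
  shows "continuous_map S (pointwise_topology G \<phi> X Y) (\<lambda>g. g)"
  unfolding pointwise_topology_def using assms
  by (intro continuous_map_pullback') (auto simp: continuous_map_componentwise o_def)

text \<open>The generating set for \<open>K = {}\<close> already consists of all continuous maps.\<close>

lemma topspace_compact_open_topology:
  "topspace (compact_open_topology X Y)
    = {f \<in> extensional (topspace X). continuous_map X Y f}" (is "_ = ?R")
proof -
  have "?R \<in> {{f \<in> extensional (topspace X). continuous_map X Y f \<and> f ` K \<subseteq> U} | K U.
      compactin X K \<and> openin Y U}"
    by (rule CollectI, rule exI[of _ "{}"], rule exI[of _ "{}"]) simp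
  then show ?thesis
    unfolding compact_open_topology_def topology_generated_by_topspace by blast
qed

lemma openin_compact_open_subbasic:
  assumes "compactin X K" "openin Y U"
  shows "openin (compact_open_topology X Y)
    {f \<in> extensional (topspace X). continuous_map X Y f \<and> f ` K \<subseteq> U}"
  unfolding compact_open_topology_def using assms
  by (intro topology_generated_by_Basis) blast

section \<open>Sets of simplicial maps\<close>

locale simplicial_self_maps =
  fixes V :: "'v set" and \<Delta> :: "'v set set" and G :: "('v \<Rightarrow> 'v) set"
  assumes complex: "abstract_simplicial_complex V \<Delta>"
    and simplicial: "\<And>g a. g \<in> G \<Longrightarrow> a \<in> \<Delta> \<Longrightarrow> g ` a \<in> \<Delta>"
begin

abbreviation TG :: "('v \<Rightarrow> 'v) topology" where
  "TG \<equiv> pointwise_topology G (\<lambda>g. g) V (discrete_topology V)"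

lemma finite_simplex: "a \<in> \<Delta> \<Longrightarrow> finite a"
  using complex unfolding abstract_simplicial_complex_def by (elim conjE) (drule (1) bspec, simp)

lemma simplex_subset: "a \<in> \<Delta> \<Longrightarrow> a \<subseteq> V"
  using complex unfolding abstract_simplicial_complex_def by (elim conjE) (drule (1) bspec, simp)

lemma singleton_simplex:
  assumes "v \<in> V"
  shows "{v} \<in> \<Delta>"
proof -
  obtain a where a: "a \<in> \<Delta>" "v \<in> a"
    using assms complex unfolding abstract_simplicial_complex_def by (elim conjE) blast
  have "\<forall>a\<in>\<Delta>. \<forall>b. b \<subseteq> a \<longrightarrow> b \<in> \<Delta>"
    using complex unfolding abstract_simplicial_complex_def by (elim conjE)
  with a show ?thesis by simp
qed

lemma vertex_in_realization:
  assumes "v \<in> V"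
  shows "vertex v \<in> realization \<Delta>"
proof -
  have "vertex v \<in> simplex_realization {v}" by (simp add: simplex_realization_def)
  then show ?thesis
    unfolding realization_def using singleton_simplex[OF assms] by (rule UN_I[rotated])
qed

lemma keys_subset_vertices:
  assumes "x \<in> realization \<Delta>"
  shows "Poly_Mapping.keys x \<subseteq> V"
proof -
  obtain a where "a \<in> \<Delta>" "x \<in> simplex_realization a"
    using assms unfolding realization_def by (rule UN_E)
  then show ?thesis by (intro order_trans[OF keys_subset_simplex simplex_subset])
qed

lemma maps_vertices: "g \<in> G \<Longrightarrow> v \<in> V \<Longrightarrow> g v \<in> V"
  using simplicial[of g "{v}"] singleton_simplex[of v] simplex_subset[of "{g v}"] by simp

lemma realize_map_in_realization:
  assumes "g \<in> G" "x \<in> realization \<Delta>"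
  shows "realize_map g x \<in> realization \<Delta>"
proof -
  obtain a where "a \<in> \<Delta>" "x \<in> simplex_realization a"
    using assms(2) by (auto simp: realization_def)
  then have "realize_map g x \<in> simplex_realization (g ` a)"
    unfolding realize_map_simplex[symmetric] by simp
  then show ?thesis
    unfolding realization_def using simplicial[OF assms(1) \<open>a \<in> \<Delta>\<close>] by (rule UN_I[rotated])
qed

lemma topspace_TG: "topspace TG = G"
  using maps_vertices by (auto simp: topspace_pointwise_topology)

lemma openin_TG_agree:
  assumes "finite F" "F \<subseteq> V" "g \<in> G"
  shows "openin TG {h \<in> G. \<forall>v\<in>F. h v = g v}"
  using assms
proof (induction F)
  case empty
  then show ?case using openin_topspace[of TG] by (simp add: topspace_TG)
next
  case (insert v F)
  have v: "v \<in> V" and F: "F \<subseteq> V" using insert.prems by simp_all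
  have "openin (discrete_topology V) {g v}"
    using maps_vertices[OF \<open>g \<in> G\<close> v] by simp
  from openin_continuous_map_preimage[OF
      continuous_map_evaluation[OF v, of G "\<lambda>g. g" "discrete_topology V"] this]
  have "openin TG {h \<in> topspace TG. h v \<in> {g v}}" .
  then have "openin TG ({h \<in> topspace TG. h v \<in> {g v}} \<inter> {h \<in> G. \<forall>u\<in>F. h u = g u})"
    by (rule openin_Int) (rule insert.IH[OF F \<open>g \<in> G\<close>])
  moreover have "{h \<in> topspace TG. h v \<in> {g v}} \<inter> {h \<in> G. \<forall>u\<in>F. h u = g u}
      = {h \<in> G. \<forall>u\<in>insert v F. h u = g u}"
    by (auto simp: topspace_TG)
  ultimately show ?case by simp
qed

text \<open>The sets of the previous lemma form a neighbourhood basis. A subset of \<open>G\<close> is therefore open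
  as soon as membership of each of its elements is witnessed by finitely many values.\<close>

lemma openin_TG_if_locally_agree:
  assumes "A \<subseteq> G"
    and "\<And>g. g \<in> A \<Longrightarrow> \<exists>F. finite F \<and> F \<subseteq> V \<and> (\<forall>h\<in>G. (\<forall>v\<in>F. h v = g v) \<longrightarrow> h \<in> A)"
  shows "openin TG A"
proof (subst openin_subopen, intro ballI)
  fix g assume "g \<in> A"
  from assms(2)[OF this] obtain F where
    F: "finite F" "F \<subseteq> V" "\<forall>h\<in>G. (\<forall>v\<in>F. h v = g v) \<longrightarrow> h \<in> A"
    by (elim exE conjE)
  have "g \<in> G" using assms(1) \<open>g \<in> A\<close> by (rule subsetD)
  show "\<exists>T. openin TG T \<and> g \<in> T \<and> T \<subseteq> A"
  proof (intro exI conjI)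
    show "openin TG {h \<in> G. \<forall>v\<in>F. h v = g v}"
      using F(1,2) \<open>g \<in> G\<close> by (rule openin_TG_agree)
    show "g \<in> {h \<in> G. \<forall>v\<in>F. h v = g v}" using \<open>g \<in> G\<close> by simp
    show "{h \<in> G. \<forall>v\<in>F. h v = g v} \<subseteq> A" using F(3) by blast
  qed
qed

text \<open>Discreteness of the vertices allows passing from the point \<open>realize_map g (vertex v)\<close> back to
  the vertex \<open>g v\<close> by a continuous map. The other direction holds because a function that is
  locally constant on \<open>G\<close> is continuous into every space.\<close>

lemma pointwise_topology_realization_eq:
  assumes T: "topspace T = realization \<Delta>" and disc: "discrete_subset T (vertex ` V)"
  shows "pointwise_topology G realize_map (realization \<Delta>) T = TG" (is "?P = TG")
proof (rule topology_eqI_continuous_id)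
  show top: "topspace ?P = topspace TG"
    unfolding topspace_TG unfolding topspace_pointwise_topology T
    using realize_map_in_realization by auto
  show "continuous_map ?P TG (\<lambda>g. g)"
  proof (rule continuous_map_into_pointwise_topology)
    show "topspace ?P \<subseteq> G" by (simp add: top topspace_TG)
    fix v assume v: "v \<in> V"
    have "continuous_map ?P T (\<lambda>g. vertex (g v))"
      using continuous_map_evaluation[OF vertex_in_realization[OF v], of G realize_map T] by simp
    moreover have "(\<lambda>g. vertex (g v)) \<in> topspace ?P \<rightarrow> vertex ` V"
      using maps_vertices[OF _ v] by (auto simp: top topspace_TG)
    ultimately have "continuous_map ?P (subtopology T (vertex ` V)) (\<lambda>g. vertex (g v))"
      by (rule continuous_map_into_subtopology)
    moreover have "subtopology T (vertex ` V) = discrete_topology (vertex ` V)"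
      using disc unfolding discrete_subset_def by (rule conjunct2)
    ultimately have "continuous_map ?P (discrete_topology (vertex ` V)) (\<lambda>g. vertex (g v))"
      by simp
    moreover have "inv_into V vertex \<in> vertex ` V \<rightarrow> V"
      by (auto intro: inv_into_into)
    then have "continuous_map (discrete_topology (vertex ` V)) (discrete_topology V)
        (inv_into V vertex)"
      by simp
    ultimately have "continuous_map ?P (discrete_topology V)
        (inv_into V vertex \<circ> (\<lambda>g. vertex (g v)))"
      by (rule continuous_map_compose)
    then show "continuous_map ?P (discrete_topology V) (\<lambda>g. g v)"
    proof (rule continuous_map_eq)
      fix g assume "g \<in> topspace ?P"
      then have "g v \<in> V" using maps_vertices[OF _ v] by (simp add: top topspace_TG)
      moreover have "inj_on vertex V" by (simp add: inj_on_def)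
      ultimately show "(inv_into V vertex \<circ> (\<lambda>g. vertex (g v))) g = g v"
        by (simp add: inv_into_f_f)
    qed
  qed
  show "continuous_map TG ?P (\<lambda>g. g)"
  proof (rule continuous_map_into_pointwise_topology)
    show "topspace TG \<subseteq> G" by (simp add: topspace_TG)
    fix x assume x: "x \<in> realization \<Delta>"
    show "continuous_map TG T (\<lambda>g. realize_map g x)"
      unfolding continuous_map_def
    proof (intro conjI allI impI)
      show "(\<lambda>g. realize_map g x) \<in> topspace TG \<rightarrow> topspace T"
        using realize_map_in_realization x by (auto simp: T topspace_TG)
      fix U
      \<comment> \<open>The value at \<open>x\<close> is already determined by the values on the support of \<open>x\<close>.\<close>
      show "openin TG {g \<in> topspace TG. realize_map g x \<in> U}"
        unfolding topspace_TG
      proof (rule openin_TG_if_locally_agree)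
        fix g assume g: "g \<in> {g \<in> G. realize_map g x \<in> U}"
        have "h \<in> {g \<in> G. realize_map g x \<in> U}"
          if "h \<in> G" "\<forall>v\<in>Poly_Mapping.keys x. h v = g v" for h
        proof -
          have "realize_map h x = realize_map g x"
            using that(2) by (intro realize_map_cong) simp
          then show ?thesis using g \<open>h \<in> G\<close> by simp
        qed
        then show "\<exists>F. finite F \<and> F \<subseteq> V \<and>
            (\<forall>h\<in>G. (\<forall>v\<in>F. h v = g v) \<longrightarrow> h \<in> {g \<in> G. realize_map g x \<in> U})"
          by (intro exI[of _ "Poly_Mapping.keys x"] conjI ballI impI keys_subset_vertices[OF x]
              finite_keys)
      qed blast
    qed
  qed
qed

text \<open>The two subbases are compared as follows: the condition \<open>g v = w\<close> says that \<open>g\<close> maps the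
  compact set \<open>{vertex v}\<close> into the open star of \<open>w\<close>, while the image of a compact set depends
  only on the values of \<open>g\<close> on its finite total support.\<close>

lemma compact_open_topology_realization_eq:
  "induced_compact_open_topology G realize_map (weak_topology \<Delta>) (weak_topology \<Delta>) = TG"
  (is "?K = TG")
proof (rule topology_eqI_continuous_id)
  let ?W = "weak_topology \<Delta>" and ?r = "\<lambda>g. restrict (realize_map g) (realization \<Delta>)"
  have cont: "continuous_map ?W ?W (?r g)" if "g \<in> G" for g
    using continuous_map_realize_map_weak[OF finite_simplex simplicial[OF that]]
    by (rule continuous_map_eq) simp_all
  show top: "topspace ?K = topspace TG"
    unfolding topspace_TG induced_compact_open_topology_def topspace_pullback_topology
      topspace_compact_open_topology
    using cont by auto
  show "continuous_map ?K TG (\<lambda>g. g)"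
  proof (rule continuous_map_into_pointwise_topology)
    show "topspace ?K \<subseteq> G" by (simp add: top topspace_TG)
    fix v assume v: "v \<in> V"
    show "continuous_map ?K (discrete_topology V) (\<lambda>g. g v)"
      unfolding continuous_map_def
    proof (intro conjI allI impI)
      show "(\<lambda>g. g v) \<in> topspace ?K \<rightarrow> topspace (discrete_topology V)"
        using maps_vertices v by (auto simp: top topspace_TG)
      fix U assume "openin (discrete_topology V) U"
      \<comment> \<open>The only vertices in the union of the open stars of the elements of \<open>U\<close> are those
        elements themselves.\<close>
      define A where "A = {f \<in> extensional (topspace ?W). continuous_map ?W ?W f \<and>
        f ` {vertex v} \<subseteq> (\<Union>w\<in>U. {x \<in> realization \<Delta>. w \<in> Poly_Mapping.keys x})}"
      have "openin (compact_open_topology ?W ?W) A"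
        unfolding A_def using vertex_in_realization[OF v]
        by (intro openin_compact_open_subbasic openin_Union)
          (auto intro: openin_weak_open_star)
      moreover have "?r g \<in> A \<longleftrightarrow> g v \<in> U" if "g \<in> G" for g
        using cont[OF that] vertex_in_realization[OF v]
          vertex_in_realization[OF maps_vertices[OF that v]]
        by (simp add: A_def)
      then have "{g \<in> topspace ?K. g v \<in> U} = ?r -` A \<inter> G"
        unfolding top topspace_TG by blast
      ultimately show "openin ?K {g \<in> topspace ?K. g v \<in> U}"
        unfolding induced_compact_open_topology_def openin_pullback_topology by force
    qed
  qed
  show "continuous_map TG ?K (\<lambda>g. g)"
    unfolding induced_compact_open_topology_def topspace_weak_topology
  proof (rule continuous_map_pullback')
    show "topspace TG \<subseteq> (\<lambda>g. g) -` G" by (simp add: topspace_TG)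
    show "continuous_map TG (compact_open_topology ?W ?W) (?r \<circ> (\<lambda>g. g))"
      unfolding compact_open_topology_def
    proof (rule continuous_on_generated_topo)
      fix A assume "A \<in> {{f \<in> extensional (topspace ?W). continuous_map ?W ?W f \<and> f ` K \<subseteq> U} | K U.
        compactin ?W K \<and> openin ?W U}"
      then obtain K U where K: "compactin ?W K"
        and A: "A = {f \<in> extensional (realization \<Delta>). continuous_map ?W ?W f \<and> f ` K \<subseteq> U}"
        by auto
      have KX: "K \<subseteq> realization \<Delta>" using compactin_subset_topspace[OF K] by simp
      let ?F = "\<Union>x\<in>K. Poly_Mapping.keys x"
      have "openin TG {g \<in> G. realize_map g ` K \<subseteq> U}"
      proof (rule openin_TG_if_locally_agree)
        fix g assume g: "g \<in> {g \<in> G. realize_map g ` K \<subseteq> U}"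
        have "h \<in> {g \<in> G. realize_map g ` K \<subseteq> U}"
          if "h \<in> G" "\<forall>v\<in>?F. h v = g v" for h
        proof -
          have "realize_map h ` K = realize_map g ` K"
            using that(2) by (intro image_cong realize_map_cong) auto
          then show ?thesis using g \<open>h \<in> G\<close> by simp
        qed
        moreover have "?F \<subseteq> V" using keys_subset_vertices KX by blast
        ultimately show "\<exists>F. finite F \<and> F \<subseteq> V \<and>
            (\<forall>h\<in>G. (\<forall>v\<in>F. h v = g v) \<longrightarrow> h \<in> {g \<in> G. realize_map g ` K \<subseteq> U})"
          using finite_support_of_weakly_compact[OF finite_simplex K]
          by (intro exI[of _ ?F] conjI ballI impI)
      qed auto
      moreover have "(?r \<circ> (\<lambda>g. g)) -` A \<inter> topspace TG = {g \<in> G. realize_map g ` K \<subseteq> U}"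
        using cont KX by (auto simp: A topspace_TG)
      ultimately show "openin TG ((?r \<circ> (\<lambda>g. g)) -` A \<inter> topspace TG)" by simp
    next
      show "(?r \<circ> (\<lambda>g. g)) ` topspace TG \<subseteq> \<Union> {{f \<in> extensional (topspace ?W).
          continuous_map ?W ?W f \<and> f ` K \<subseteq> U} | K U. compactin ?W K \<and> openin ?W U}"
        using cont topspace_compact_open_topology[of ?W ?W]
        unfolding compact_open_topology_def topology_generated_by_topspace
        by (auto simp: topspace_TG)
    qed
  qed
qed

text \<open>Both criteria for joint continuity produce, near \<open>(g, x)\<close>, a product of a neighbourhood
  \<open>U\<close> of \<open>x\<close> with one of the basic neighbourhoods of \<open>g\<close>, given by a finite set \<open>F\<close>.\<close>

lemma continuous_map_joint_evaluation:
  assumes T: "topspace T = realization \<Delta>"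
    and loc: "\<And>g x W. g \<in> G \<Longrightarrow> x \<in> realization \<Delta> \<Longrightarrow> openin T W \<Longrightarrow> realize_map g x \<in> W \<Longrightarrow>
      \<exists>F U. finite F \<and> F \<subseteq> V \<and> openin T U \<and> x \<in> U \<and>
        (\<forall>h\<in>G. \<forall>y\<in>U. (\<forall>v\<in>F. h v = g v) \<longrightarrow> realize_map h y \<in> W)"
  shows "continuous_map (prod_topology TG T) T (\<lambda>(g, x). realize_map g x)"
  unfolding continuous_map_def
proof (intro conjI allI impI)
  show "(\<lambda>(g, x). realize_map g x) \<in> topspace (prod_topology TG T) \<rightarrow> topspace T"
    using realize_map_in_realization by (auto simp: T topspace_TG)
  fix W assume W: "openin T W"
  show "openin (prod_topology TG T)
      {p \<in> topspace (prod_topology TG T). (case p of (g, x) \<Rightarrow> realize_map g x) \<in> W}"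
    unfolding openin_prod_topology_alt
  proof (intro allI impI)
    fix g x
    assume "(g, x) \<in> {p \<in> topspace (prod_topology TG T). (case p of (g, x) \<Rightarrow> realize_map g x) \<in> W}"
    then have g: "g \<in> G" and x: "x \<in> realization \<Delta>" and gx: "realize_map g x \<in> W"
      by (auto simp: topspace_TG T)
    obtain F U where FU: "finite F" "F \<subseteq> V" "openin T U" "x \<in> U"
      "\<forall>h\<in>G. \<forall>y\<in>U. (\<forall>v\<in>F. h v = g v) \<longrightarrow> realize_map h y \<in> W"
      using loc[OF g x W gx] by (elim exE conjE)
    have "U \<subseteq> topspace T" using FU(3) by (rule openin_subset)
    show "\<exists>A U. openin TG A \<and> openin T U \<and> g \<in> A \<and> x \<in> U \<and> A \<times> U \<subseteq>
        {p \<in> topspace (prod_topology TG T). (case p of (g, x) \<Rightarrow> realize_map g x) \<in> W}"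
    proof (intro exI conjI)
      show "openin TG {h \<in> G. \<forall>v\<in>F. h v = g v}"
        using FU(1,2) g by (rule openin_TG_agree)
      show "g \<in> {h \<in> G. \<forall>v\<in>F. h v = g v}" using g by simp
      show "{h \<in> G. \<forall>v\<in>F. h v = g v} \<times> U \<subseteq>
          {p \<in> topspace (prod_topology TG T). (case p of (g, x) \<Rightarrow> realize_map g x) \<in> W}"
        using FU(5) \<open>U \<subseteq> topspace T\<close> by (auto simp: topspace_TG)
    qed (fact FU)+
  qed
qed

text \<open>Take for \<open>F\<close> the vertices of a finite subcomplex around \<open>x\<close>: on a neighbourhood inside this
  subcomplex the maps in the basic neighbourhood of \<open>g\<close> are equal to \<open>g\<close>.\<close>

lemma continuous_map_joint_evaluation_locally_finite:
  assumes T: "topspace T = realization \<Delta>"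
    and cont: "\<And>g. g \<in> G \<Longrightarrow> continuous_map T T (realize_map g)"
    and lf: "locally_finite_topology \<Delta> T"
  shows "continuous_map (prod_topology TG T) T (\<lambda>(g, x). realize_map g x)"
proof (rule continuous_map_joint_evaluation[OF T])
  fix g x W
  assume g: "g \<in> G" and x: "x \<in> realization \<Delta>" and W: "openin T W" and gx: "realize_map g x \<in> W"
  obtain U \<F> where U: "openin T U" "x \<in> U" "U \<subseteq> realization \<F>" and \<F>: "\<F> \<subseteq> \<Delta>" "finite \<F>"
    using lf x unfolding locally_finite_topology_def by metis
  have keys: "Poly_Mapping.keys y \<subseteq> \<Union>\<F>" if y: "y \<in> U" for y
  proof -
    obtain a where "a \<in> \<F>" "y \<in> simplex_realization a"
      using subsetD[OF U(3) y] unfolding realization_def by (rule UN_E)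
    then show ?thesis by (intro order_trans[OF keys_subset_simplex Union_upper])
  qed
  have "finite (\<Union>\<F>)"
    using \<F> finite_simplex by (intro finite_Union) (rule \<F>(2), drule subsetD[OF \<F>(1)])
  moreover have "\<Union>\<F> \<subseteq> V"
    using \<F>(1) simplex_subset by (intro Union_least) (drule subsetD[OF \<F>(1)])
  moreover have "openin T (U \<inter> {y \<in> topspace T. realize_map g y \<in> W})"
    by (intro openin_Int U openin_continuous_map_preimage[OF cont[OF g] W])
  moreover have "realize_map h y \<in> W"
    if "y \<in> U \<inter> {y \<in> topspace T. realize_map g y \<in> W}" "\<forall>v\<in>\<Union>\<F>. h v = g v" for h y
  proof -
    have "realize_map h y = realize_map g y"
      using that(2) keys[OF IntD1[OF that(1)]] by (intro realize_map_cong) blast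
    then show ?thesis using that(1) by simp
  qed
  moreover have "x \<in> U \<inter> {y \<in> topspace T. realize_map g y \<in> W}"
    using U(2) x gx T by simp
  ultimately show "\<exists>F U. finite F \<and> F \<subseteq> V \<and> openin T U \<and> x \<in> U \<and>
      (\<forall>h\<in>G. \<forall>y\<in>U. (\<forall>v\<in>F. h v = g v) \<longrightarrow> realize_map h y \<in> W)"
    by (intro exI[of _ "\<Union>\<F>"] exI[of _ "U \<inter> {y \<in> topspace T. realize_map g y \<in> W}"] conjI ballI impI)
qed

text \<open>Take for \<open>F\<close> the support of \<open>x\<close>: the maps in question send \<open>x\<close> to the same point as \<open>g\<close>,
  and being isometries they send the ball of radius \<open>e\<close> at \<open>x\<close> into the ball of radius \<open>e\<close> at
  that point.\<close>

lemma continuous_map_joint_evaluation_metric: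
  assumes inv: "invariant_metric G realize_map (realization \<Delta>) d"
  defines "T \<equiv> Metric_space.mtopology (realization \<Delta>) d"
  shows "continuous_map (prod_topology TG T) T (\<lambda>(g, x). realize_map g x)"
proof -
  interpret Metric_space "realization \<Delta>" d
    using inv by (simp add: invariant_metric_def)
  show ?thesis
    unfolding T_def
  proof (rule continuous_map_joint_evaluation)
    fix g x W
    assume g: "g \<in> G" and x: "x \<in> realization \<Delta>" and W: "openin mtopology W"
      and gx: "realize_map g x \<in> W"
    have "\<forall>z\<in>W. \<exists>e>0. mball z e \<subseteq> W" using W by (simp add: openin_mtopology)
    from bspec[OF this gx] obtain e where e: "e > 0" "mball (realize_map g x) e \<subseteq> W"
      by (elim exE conjE)
    have "realize_map h y \<in> W"
      if h: "h \<in> G" and y: "y \<in> mball x e" and agree: "\<forall>v\<in>Poly_Mapping.keys x. h v = g v" for h y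
    proof -
      have yX: "y \<in> realization \<Delta>" and "d x y < e" using y by (simp_all add: in_mball)
      have "realize_map g x = realize_map h x"
        using agree by (intro realize_map_cong) simp
      moreover have "d (realize_map h x) (realize_map h y) = d x y"
        using inv h x yX by (simp add: invariant_metric_def)
      ultimately have "realize_map h y \<in> mball (realize_map g x) e"
        using \<open>d x y < e\<close> realize_map_in_realization[OF h x] realize_map_in_realization[OF h yX]
        by (simp add: in_mball)
      with e(2) show ?thesis by (rule subsetD)
    qed
    moreover have "x \<in> mball x e" using e(1) x by simp
    ultimately show "\<exists>F U. finite F \<and> F \<subseteq> V \<and> openin mtopology U \<and> x \<in> U \<and>
        (\<forall>h\<in>G. \<forall>y\<in>U. (\<forall>v\<in>F. h v = g v) \<longrightarrow> realize_map h y \<in> W)"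
      by (intro exI[of _ "Poly_Mapping.keys x"] exI[of _ "mball x e"] conjI ballI impI
          keys_subset_vertices[OF x] finite_keys openin_mball)
  qed simp
qed

end

section \<open>Automorphisms of buildings\<close>

lemma (in building) simplicial_building_aut:
  "simplicial_self_maps C (chamber_complex C EC) (building_aut C EC t)"
proof
  show "abstract_simplicial_complex C (chamber_complex C EC)"
    by (rule abstract_simplicial_complex_chamber_complex)
  fix g a assume g: "g \<in> building_aut C EC t" and a: "a \<in> chamber_complex C EC"
  have "g c \<in> C" if "c \<in> C" for c
    using g that by (auto simp: building_aut_def Bij_def bij_betw_def)
  moreover have "g ` e \<in> EC" if "e \<in> EC" for e
  proof -
    obtain x y where "e = {x, y}" "x \<in> C" "y \<in> C"
      using edges \<open>e \<in> EC\<close> by (auto simp: card_2_iff)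
    then show ?thesis using g \<open>e \<in> EC\<close> by (auto simp: building_aut_def)
  qed
  ultimately show "g ` a \<in> chamber_complex C EC"
    using a by (auto simp: chamber_complex_def)
qed

theorem proposition5p3:
  fixes I :: "'i set" and m :: "'i \<Rightarrow> 'i \<Rightarrow> enat"
    and C :: "'c set" and EC :: "'c set set" and t :: "'c set \<Rightarrow> 'i"
    and \<delta> :: "'c \<Rightarrow> 'c \<Rightarrow> ('i \<times> bool) list set"
  assumes "building I m C EC t \<delta>"
  shows
    "let G = building_aut C EC t;
         \<Delta> = chamber_complex C EC;
         X = realization \<Delta>;
         TG = pointwise_topology G (\<lambda>g. g) C (discrete_topology C)
     in (\<forall>T. topspace T = X \<and> Hausdorff_space T \<and> discrete_subset T (vertex ` C)
            \<longrightarrow> pointwise_topology G realize_map X T = TG)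
      \<and> induced_compact_open_topology G realize_map (weak_topology \<Delta>) (weak_topology \<Delta>) = TG
      \<and> (\<forall>T. topspace T = X \<and> Hausdorff_space T \<and>
            (invariant_topology G realize_map T \<and> locally_finite_topology \<Delta> T
             \<or> (\<exists>d. invariant_metric G realize_map X d \<and> T = Metric_space.mtopology X d
                  \<and> discrete_subset T (vertex ` C)))
            \<longrightarrow> continuous_map (prod_topology TG T) T (\<lambda>(g, x). realize_map g x))"
proof -
  interpret building I m C EC t \<delta> by (fact assms)
  interpret simplicial_self_maps C "chamber_complex C EC" "building_aut C EC t"
    by (rule simplicial_building_aut)
  show ?thesis
    unfolding Let_def
  proof (intro conjI allI impI)
    show "pointwise_topology (building_aut C EC t) realize_map
        (realization (chamber_complex C EC)) T = TG"
      if "topspace T = realization (chamber_complex C EC) \<and> Hausdorff_space T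
        \<and> discrete_subset T (vertex ` C)" for T
      using that by (intro pointwise_topology_realization_eq) simp_all
    show "induced_compact_open_topology (building_aut C EC t) realize_map
        (weak_topology (chamber_complex C EC)) (weak_topology (chamber_complex C EC)) = TG"
      by (rule compact_open_topology_realization_eq)
    fix T
    assume T: "topspace T = realization (chamber_complex C EC) \<and> Hausdorff_space T
      \<and> (invariant_topology (building_aut C EC t) realize_map T
          \<and> locally_finite_topology (chamber_complex C EC) T
        \<or> (\<exists>d. invariant_metric (building_aut C EC t) realize_map
              (realization (chamber_complex C EC)) d
            \<and> T = Metric_space.mtopology (realization (chamber_complex C EC)) d
            \<and> discrete_subset T (vertex ` C)))"
    then consider
      (loc_fin) "invariant_topology (building_aut C EC t) realize_map T"
        "locally_finite_topology (chamber_complex C EC) T"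
      | (metric) d where "invariant_metric (building_aut C EC t) realize_map
          (realization (chamber_complex C EC)) d"
        "T = Metric_space.mtopology (realization (chamber_complex C EC)) d"
      by (elim conjE disjE exE)
    then show "continuous_map (prod_topology TG T) T (\<lambda>(g, x). realize_map g x)"
    proof cases
      case loc_fin
      then show ?thesis
        using T
        by (intro continuous_map_joint_evaluation_locally_finite)
          (auto simp: invariant_topology_def intro: homeomorphic_imp_continuous_map)
    next
      case metric
      then show ?thesis using continuous_map_joint_evaluation_metric by simp
    qed
  qed
qed

end
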